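(* Let $m$ be a positive integer, $S_{2m}$ the symmetric group on $\{1,\dots,2m\}$, and $H$ the centralizer in $S_{2m}$ of $(1\ 2)(3\ 4)\cdots(2m-1\ 2m)$. There is a constant $C>0$ such that \[\frac{\#\{g\in S_{2m}: |H\cap gHg^{-1}|>Cm^{\log m}\}}{(2m)!}\longrightarrow 0 \quad\text{as } m\to\infty.\] In particular, the elements $g\in S_{2m}$ with $|H\cap gHg^{-1}|\gg m^{\log m}$ have density zero.
   Context: Probabilities are with respect to the uniform distribution on $S_{2m}$; $\log$ is the natural logarithm. *)

theory Defs
  imports
    Complex_Main
    "HOL-Algebra.Sym_Groups"
begin

definition centralizer :: "('a, 'b) monoid_scheme \<Rightarrow> 'a \<Rightarrow> 'a set" where
  "centralizer G x = {h \<in> carrier G. h \<otimes>\<^bsub>G\<^esub> x = x \<otimes>\<^bsub>G\<^esub> h}"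

definition conj_subgroup :: "('a, 'b) monoid_scheme \<Rightarrow> 'a \<Rightarrow> 'a set \<Rightarrow> 'a set" where
  "conj_subgroup G g K = g <#\<^bsub>G\<^esub> K #>\<^bsub>G\<^esub> inv\<^bsub>G\<^esub> g"

text \<open>The permutation (1 2)(3 4) ... (2m-1 2m) of {1..2m}.\<close>

primrec pairing :: "nat \<Rightarrow> nat \<Rightarrow> nat" where
  "pairing 0 = id"
| "pairing (Suc m) = pairing m \<circ> transpose (2 * m + 1) (2 * m + 2)"

definition pairing_centralizer :: "nat \<Rightarrow> (nat \<Rightarrow> nat) set" where
  "pairing_centralizer m = centralizer (sym_group (2 * m)) (pairing m)"

definition pairing_centralizer_meet :: "nat \<Rightarrow> (nat \<Rightarrow> nat) \<Rightarrow> (nat \<Rightarrow> nat) set" where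
  "pairing_centralizer_meet m g = pairing_centralizer m \<inter> conj_subgroup (sym_group (2 * m)) g (pairing_centralizer m)"

lemma pairing_permutes: "pairing m permutes {1..2 * m}"
proof (induction m)
  case (Suc m)
  have "pairing m permutes {1..2 * Suc m}"
    by (rule permutes_subset[OF Suc]) auto
  moreover have "transpose (2 * m + 1) (2 * m + 2) permutes {1..2 * Suc m}"
    by (rule permutes_swap_id) auto
  ultimately show ?case
    by (simp only: pairing.simps permutes_compose)
qed (simp add: permutes_id[unfolded id_def] id_def)

end

theory Submission
  imports
    Defs
    "HOL-Combinatorics.Orbits"
    "HOL-Real_Asymp.Real_Asymp"
    "HOL-Analysis.Harmonic_Numbers"
begin

text \<open>Let \<open>\<tau>\<close> be the pairing, \<open>\<sigma> = g \<tau> g\<^sup>-\<^sup>1\<close>, and let \<open>K\<close> be the number of orbits of the dihedral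
  group generated by \<open>\<tau>\<close> and \<open>\<sigma>\<close>. An element of \<open>H \<inter> g H g\<^sup>-\<^sup>1\<close> commutes with both
  involutions, so it is determined by its values at one point of each orbit, and the
  intersection has at most \<open>(2m)\<^sup>K\<close> elements. On the other hand each orbit splits into two halves
  interchanged by \<open>\<tau>\<close> and by \<open>\<sigma>\<close>, so there are at least \<open>2\<^sup>K\<close> sets meeting every cycle of \<open>\<tau>\<close>
  and every cycle of \<open>\<sigma>\<close> in exactly one point. Counting triples of a permutation \<open>g\<close> and
  transversals \<open>A\<close>, \<open>B\<close> of \<open>\<tau>\<close> with \<open>g B = A\<close> bounds the sum of \<open>2\<^sup>K\<close> over all \<open>g\<close> by
  \<open>(2\<^sup>m m!)\<^sup>2\<close>, which is at most \<open>2 \<surd>m (2m)!\<close>. If the intersection has at least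
  \<open>c m\<^bsup>log m\<^esup>\<close> elements then \<open>K \<ge> log m - 2\<close> for large \<open>m\<close>, so by Markov's inequality this has
  probability at most \<open>8 m\<^bsup>1/2 - log 2\<^esup>\<close>, and \<open>log 2 > 1/2\<close>.\<close>

section \<open>Permutations carrying one set to another\<close>

lemma card_permutes_image_le:
  assumes "finite X" "A \<subseteq> X" "B \<subseteq> X" "card A = card B"
  shows "card {g. g permutes X \<and> g ` B = A} \<le> fact (card B) * fact (card (X - B))"
proof -
  have card_inj: "card {f \<in> S \<rightarrow>\<^sub>E T. inj_on f S} = fact (card S)"
    and fin_inj: "finite {f \<in> S \<rightarrow>\<^sub>E T. inj_on f S}"
    if "S \<subseteq> X" "T \<subseteq> X" "card T = card S" for S T
  proof -
    have "finite S" "finite T"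
      using that assms(1) finite_subset by blast+
    then show "card {f \<in> S \<rightarrow>\<^sub>E T. inj_on f S} = fact (card S)"
      using that by (subst card_inj_on_subset_funcset) (auto simp: fact_prod_rev)
    show "finite {f \<in> S \<rightarrow>\<^sub>E T. inj_on f S}"
      using \<open>finite S\<close> \<open>finite T\<close> by (auto intro: finite_subset[OF _ finite_PiE[of S "\<lambda>_. T"]])
  qed
  have compl: "card (X - A) = card (X - B)"
    using assms by (metis card_Diff_subset finite_subset)
  \<comment> \<open>A permutation taking \<open>B\<close> to \<open>A\<close> takes
    \<open>X - B\<close> to \<open>X - A\<close>, so it splits into two injections, which together
    determine it.\<close>
  let ?F = "{f \<in> B \<rightarrow>\<^sub>E A. inj_on f B} \<times> {f \<in> (X - B) \<rightarrow>\<^sub>E (X - A). inj_on f (X - B)}"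
  have "card {g. g permutes X \<and> g ` B = A} \<le> card ?F"
  proof (rule card_inj_on_le)
    show "inj_on (\<lambda>g. (restrict g B, restrict g (X - B))) {g. g permutes X \<and> g ` B = A}"
    proof (rule inj_onI, clarify, rule ext)
      fix g h x
      assume "g permutes X" "h permutes X" "restrict g B = restrict h B"
        "restrict g (X - B) = restrict h (X - B)"
      then show "g x = h x"
        by (cases "x \<in> B"; cases "x \<in> X")
          (metis DiffI restrict_apply' permutes_not_in)+
    qed
    show "(\<lambda>g. (restrict g B, restrict g (X - B))) ` {g. g permutes X \<and> g ` B = A} \<subseteq> ?F"
    proof (rule image_subsetI)
      fix g assume "g \<in> {g. g permutes X \<and> g ` B = A}"
      then have g: "g permutes X" "A = g ` B"
        by auto
      have "g ` (X - B) = X - g ` B"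
        using g(1) by (simp add: image_set_diff permutes_inj permutes_image)
      then have "\<And>x. x \<in> X - B \<Longrightarrow> g x \<in> X - g ` B"
        by blast
      moreover have "inj_on g S" for S
        using g(1) by (meson permutes_inj inj_on_subset subset_UNIV)
      ultimately show "(restrict g B, restrict g (X - B)) \<in> ?F"
        unfolding g(2) by (auto simp del: Diff_iff)
    qed
    show "finite ?F"
      by (intro finite_cartesian_product fin_inj) (use assms compl in auto)
  qed
  also have "\<dots> = fact (card B) * fact (card (X - B))"
    using assms compl by (simp add: card_cartesian_product card_inj)
  finally show ?thesis .
qed

section \<open>Transversals of a fixed-point-free involution\<close>

definition transversals :: "'a set \<Rightarrow> ('a \<Rightarrow> 'a) \<Rightarrow> 'a set set" where
  "transversals X \<tau> = {A. A \<subseteq> X \<and> (\<forall>x\<in>X. \<tau> x \<in> A \<longleftrightarrow> x \<notin> A)}"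

lemma finite_transversals: "finite X \<Longrightarrow> finite (transversals X \<tau>)"
  by (rule finite_subset[of _ "Pow X"]) (auto simp: transversals_def)

locale fpf_involution =
  fixes X :: "'a set" and \<tau> :: "'a \<Rightarrow> 'a"
  assumes fin: "finite X"
    and perm: "\<tau> permutes X"
    and invol: "\<tau> (\<tau> x) = x"
    and fpf: "x \<in> X \<Longrightarrow> \<tau> x \<noteq> x"
begin

lemma transversal_halves:
  assumes "A \<in> transversals X \<tau>"
  shows "card X = 2 * card A" "card (X - A) = card A"
proof -
  have A: "A \<subseteq> X" "\<And>x. x \<in> X \<Longrightarrow> \<tau> x \<in> A \<longleftrightarrow> x \<notin> A"
    using assms by (auto simp: transversals_def)
  have "X - A = \<tau> ` A"
  proof
    show "X - A \<subseteq> \<tau> ` A"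
      using A invol by (metis DiffE image_eqI subsetI)
    show "\<tau> ` A \<subseteq> X - A"
      using A invol perm permutes_in_image by fastforce
  qed
  then show *: "card (X - A) = card A"
    using perm by (simp add: card_image permutes_inj_on)
  have "card X = card A + card (X - A)"
    using A(1) fin by (metis card_Diff_subset card_mono finite_subset le_add_diff_inverse)
  with * show "card X = 2 * card A"
    by simp
qed

text \<open>Once one transversal \<open>B\<close> is fixed, any other \<open>A\<close> is recovered
  from \<open>A \<inter> B\<close>: a point of \<open>X\<close> outside \<open>B\<close> has its
  partner in \<open>B\<close>, and exactly one of the two lies in \<open>A\<close>.\<close>

lemma card_transversals_le: "card (transversals X \<tau>) \<le> 2 ^ (card X div 2)"
proof (cases "transversals X \<tau> = {}")
  case False
  then obtain B where B: "B \<in> transversals X \<tau>"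
    by blast
  then have "finite B"
    using fin finite_subset by (auto simp: transversals_def)
  have "card (transversals X \<tau>) \<le> card (Pow B)"
  proof (rule card_inj_on_le)
    show "inj_on (\<lambda>A. A \<inter> B) (transversals X \<tau>)"
    proof (rule inj_onI)
      fix A A' assume A: "A \<in> transversals X \<tau>" "A' \<in> transversals X \<tau>" "A \<inter> B = A' \<inter> B"
      have "x \<in> A \<longleftrightarrow> x \<in> A'" if "x \<in> X" for x
        using A B that unfolding transversals_def by blast
      then show "A = A'"
        using A(1,2) unfolding transversals_def by blast
    qed
    show "finite (Pow B)"
      using \<open>finite B\<close> by simp
  qed auto
  also have "\<dots> = 2 ^ (card X div 2)"
    using transversal_halves(1)[OF B] \<open>finite B\<close> by (simp add: card_Pow)
  finally show ?thesis .
qed auto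

lemma conjugate:
  assumes "g permutes X"
  shows "fpf_involution X (g \<circ> \<tau> \<circ> inv' g)"
proof
  show "g \<circ> \<tau> \<circ> inv' g permutes X"
    using assms perm permutes_inv permutes_compose by blast
  show "(g \<circ> \<tau> \<circ> inv' g) ((g \<circ> \<tau> \<circ> inv' g) x) = x" for x
    using assms by (simp add: permutes_inverses invol)
  show "(g \<circ> \<tau> \<circ> inv' g) x \<noteq> x" if "x \<in> X" for x
  proof
    assume "(g \<circ> \<tau> \<circ> inv' g) x = x"
    then have "\<tau> (inv' g x) = inv' g x"
      using assms by (metis comp_apply permutes_inverses(2))
    moreover have "inv' g x \<in> X"
      using assms that by (metis permutes_in_image permutes_inv)
    ultimately show False
      using fpf by blast
  qed
qed (rule fin)

text \<open>Transversals of the conjugate involution are the \<open>g\<close>-images of transversals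
  of \<open>\<tau>\<close>, so \<open>A\<close> corresponds to \<open>B\<close>, its preimage under
  \<open>g\<close>.\<close>

lemma card_common_transversals_conjugate_le:
  assumes "g permutes X"
  shows "card (transversals X \<tau> \<inter> transversals X (g \<circ> \<tau> \<circ> inv' g))
    \<le> card {B \<in> transversals X \<tau>. g ` B \<in> transversals X \<tau>}"
proof (rule card_inj_on_le)
  have bij: "bij g"
    using assms permutes_bij by blast
  show "inj_on ((`) (inv' g)) (transversals X \<tau> \<inter> transversals X (g \<circ> \<tau> \<circ> inv' g))"
    using bij by (intro inj_onI) (simp add: inj_image_eq_iff bij_imp_bij_inv bij_is_inj)
  show "(`) (inv' g) ` (transversals X \<tau> \<inter> transversals X (g \<circ> \<tau> \<circ> inv' g))
      \<subseteq> {B \<in> transversals X \<tau>. g ` B \<in> transversals X \<tau>}"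
  proof clarify
    fix A assume A: "A \<in> transversals X \<tau>" "A \<in> transversals X (g \<circ> \<tau> \<circ> inv' g)"
    have mem: "y \<in> inv' g ` A \<longleftrightarrow> g y \<in> A" for y
      using assms by (auto simp: image_iff permutes_inverses intro: bexI[of _ "g y"])
    have X: "g y \<in> X \<longleftrightarrow> y \<in> X" for y
      using assms permutes_in_image by metis
    have "inv' g ` A \<in> transversals X \<tau>"
      unfolding transversals_def
    proof (intro CollectI conjI ballI)
      show "inv' g ` A \<subseteq> X"
        using A(1) mem X by (auto simp: transversals_def)
      fix x assume "x \<in> X"
      then have "(g \<circ> \<tau> \<circ> inv' g) (g x) \<in> A \<longleftrightarrow> g x \<notin> A"
        using A(2) X by (simp add: transversals_def)
      then show "\<tau> x \<in> inv' g ` A \<longleftrightarrow> x \<notin> inv' g ` A"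
        using assms by (simp add: mem permutes_inverses)
    qed
    moreover have "g ` inv' g ` A = A"
      using bij by (simp add: bij_is_surj image_f_inv_f)
    ultimately show "inv' g ` A \<in> transversals X \<tau> \<and> g ` inv' g ` A \<in> transversals X \<tau>"
      using A by simp
  qed
  show "finite {B \<in> transversals X \<tau>. g ` B \<in> transversals X \<tau>}"
    by (rule finite_subset[OF _ finite_transversals[OF fin]]) auto
qed

text \<open>Double counting: with n half the size of \<open>X\<close>, there are at most 2^n choices
  for each of \<open>B\<close> and its image \<open>A\<close>, and at most n! n! permutations taking
  \<open>B\<close> to \<open>A\<close>.\<close>

lemma sum_card_common_transversals_le:
  "(\<Sum>g | g permutes X. card (transversals X \<tau> \<inter> transversals X (g \<circ> \<tau> \<circ> inv' g)))
    \<le> (2 ^ (card X div 2) * fact (card X div 2))\<^sup>2"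
proof -
  let ?T = "transversals X \<tau>" and ?G = "{g. g permutes X}" and ?n = "card X div 2"
  have finT: "finite ?T" and finG: "finite ?G"
    using fin finite_transversals finite_permutations by auto
  have "(\<Sum>g\<in>?G. card (?T \<inter> transversals X (g \<circ> \<tau> \<circ> inv' g)))
      \<le> (\<Sum>g\<in>?G. card {B \<in> ?T. g ` B \<in> ?T})"
    by (intro sum_mono card_common_transversals_conjugate_le) auto
  also have "\<dots> = (\<Sum>B\<in>?T. card {g \<in> ?G. g ` B \<in> ?T})"
    by (rule sum_multicount_gen[OF finG finT]) auto
  also have "\<dots> \<le> (\<Sum>B\<in>?T. card ?T * (fact ?n * fact ?n))"
  proof (rule sum_mono)
    fix B assume B: "B \<in> ?T"
    have "card {g \<in> ?G. g ` B \<in> ?T} = card (\<Union>A\<in>?T. {g. g permutes X \<and> g ` B = A})"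
      by (rule arg_cong[where f = card]) auto
    also have "\<dots> \<le> (\<Sum>A\<in>?T. card {g. g permutes X \<and> g ` B = A})"
      by (rule card_UN_le[OF finT])
    also have "\<dots> \<le> (\<Sum>A\<in>?T. fact ?n * fact ?n)"
    proof (rule sum_mono)
      fix A assume A: "A \<in> ?T"
      have "card {g. g permutes X \<and> g ` B = A} \<le> fact (card B) * fact (card (X - B))"
        using A B transversal_halves(1)[OF A] transversal_halves(1)[OF B]
        by (intro card_permutes_image_le fin) (auto simp: transversals_def)
      then show "card {g. g permutes X \<and> g ` B = A} \<le> fact ?n * fact ?n"
        using transversal_halves[OF B] by simp
    qed
    finally show "card {g \<in> ?G. g ` B \<in> ?T} \<le> card ?T * (fact ?n * fact ?n)"
      by simp
  qed
  also have "\<dots> = (card ?T * fact ?n)\<^sup>2"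
    by (simp add: power2_eq_square)
  also have "\<dots> \<le> (2 ^ ?n * fact ?n)\<^sup>2"
    by (intro power_mono mult_right_mono card_transversals_le) auto
  finally show ?thesis .
qed

end

section \<open>Two involutions and their dihedral orbits\<close>

locale fpf_involution_pair = fpf_involution X \<tau> + other: fpf_involution X \<sigma>
  for X :: "'a set" and \<tau> \<sigma> :: "'a \<Rightarrow> 'a"
begin

definition rotation :: "'a \<Rightarrow> 'a" where
  "rotation = \<tau> \<circ> \<sigma>"

lemma permutation_rotation: "permutation rotation"
  using fin perm other.perm permutes_compose unfolding rotation_def permutation_permutes by blast

lemma orbit_rotation_iff: "y \<in> orbit rotation x \<longleftrightarrow> (\<exists>n. y = (rotation ^^ n) x)"
  by (simp add: orbit_altdef_permutation[OF permutation_rotation])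

lemma self_in_orbit: "x \<in> orbit rotation x"
  by (rule permutation_self_in_orbit[OF permutation_rotation])

lemma orbit_sym: "y \<in> orbit rotation x \<Longrightarrow> x \<in> orbit rotation y"
  by (rule orbit_swap[OF self_in_orbit])

lemma orbit_in: "x \<in> X \<Longrightarrow> y \<in> orbit rotation x \<Longrightarrow> y \<in> X"
  using permutes_orbit_subset[of rotation X x] perm other.perm permutes_compose
  unfolding rotation_def by blast

text \<open>Conjugation by \<open>\<tau>\<close> inverts the rotation, so \<open>\<tau>\<close> maps
  rotation orbits to rotation orbits.\<close>

lemma orbit_reflect:
  assumes "y \<in> orbit rotation x"
  shows "\<tau> y \<in> orbit rotation (\<tau> x)"
proof -
  have "(rotation ^^ n) (\<tau> ((rotation ^^ n) x)) = \<tau> x" for n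
  proof (induction n)
    case (Suc n)
    have "rotation (\<tau> (rotation z)) = \<tau> z" for z
      by (simp add: rotation_def invol other.invol)
    with Suc show ?case
      by (metis comp_apply funpow.simps(2) funpow_Suc_right)
  qed simp
  then have "\<tau> x \<in> orbit rotation (\<tau> y)"
    using assms unfolding orbit_rotation_iff by metis
  then show ?thesis
    by (rule orbit_sym)
qed

text \<open>If the rotation r had r^(n+2) x = \<open>\<tau> x\<close>, then r^n (r x) =
  \<open>\<tau>\<close> (r x). Descending in steps of two ends in a fixed point of
  \<open>\<tau>\<close> (n = 0) or of \<open>\<sigma>\<close> (n = 1).\<close>

lemma reflect_notin_orbit:
  assumes "x \<in> X"
  shows "\<tau> x \<notin> orbit rotation x"
proof -
  have X: "\<tau> y \<in> X" "\<sigma> y \<in> X" if "y \<in> X" for y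
    using that perm other.perm by (simp_all add: permutes_in_image)
  have "(rotation ^^ n) x \<noteq> \<tau> x" for n
    using assms
  proof (induction n arbitrary: x rule: induct_nat_012)
    case 0
    then show ?case using fpf by (metis funpow_0)
  next
    case 1
    then show ?case
      using other.fpf invol by (auto simp: rotation_def) metis
  next
    case (ge2 n)
    have "rotation x \<in> X"
      using ge2.prems X by (simp add: rotation_def)
    then have IH: "(rotation ^^ n) (rotation x) \<noteq> \<tau> (rotation x)"
      using ge2.IH by blast
    have "rotation ((rotation ^^ n) (rotation x)) \<noteq> \<tau> x"
      using IH invol other.invol unfolding rotation_def by (metis comp_apply)
    then show ?case
      by (simp add: funpow_swap1)
  qed
  then show ?thesis
    unfolding orbit_rotation_iff by metis
qed

text \<open>The orbits of the dihedral group generated by the two involutions.\<close>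

definition block :: "'a \<Rightarrow> 'a set" where
  "block x = orbit rotation x \<union> orbit rotation (\<tau> x)"

text \<open>The choice depends on the block only as a set, so all points of a block share one
  representative and the image of \<open>X\<close> under \<open>rep\<close> indexes the
  blocks.\<close>

definition rep :: "'a \<Rightarrow> 'a" where
  "rep x = (SOME y. y \<in> block x)"

lemma orbit_eq: "y \<in> orbit rotation x \<Longrightarrow> orbit rotation y = orbit rotation x"
  using orbit_sym orbit_trans by (metis subsetI subset_antisym)

lemma block_eq: "y \<in> block x \<Longrightarrow> block y = block x"
  using orbit_eq orbit_reflect invol unfolding block_def by (metis Un_commute Un_iff)

lemma rep_in_block: "rep x \<in> block x"
  unfolding rep_def using self_in_orbit by (intro someI) (auto simp: block_def)

lemma rep_cong: "y \<in> block x \<Longrightarrow> rep y = rep x"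
  using block_eq by (metis rep_def)

lemma rep_in: "x \<in> X \<Longrightarrow> rep x \<in> X"
  using rep_in_block[of x] orbit_in[of x "rep x"] orbit_in[of "\<tau> x" "rep x"] perm by (auto simp: block_def permutes_in_image)

text \<open>The two halves of a block are disjoint, so the representative shares its half with
  exactly one of \<open>x\<close> and \<open>\<tau> x\<close>.\<close>

lemma rep_orbit_cases:
  assumes "x \<in> X"
  shows "\<tau> x \<in> orbit rotation (rep x) \<longleftrightarrow> x \<notin> orbit rotation (rep x)"
  using rep_in_block[of x] reflect_notin_orbit[OF assms] orbit_sym orbit_trans
  unfolding block_def by (metis Un_iff)

lemma two_power_blocks_le:
  "2 ^ card (rep ` X) \<le> card (transversals X \<tau> \<inter> transversals X \<sigma>)"
proof -
  \<comment> \<open>From each block take the half containing the representative if that lies in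
    \<open>S\<close>, and the other half otherwise. The representatives in the resulting set are
    exactly those in \<open>S\<close>, whence injectivity.\<close>
  let ?A = "\<lambda>S. {x \<in> X. rep x \<in> S \<longleftrightarrow> x \<in> orbit rotation (rep x)}"
  have X: "\<tau> y \<in> X \<longleftrightarrow> y \<in> X" "\<sigma> y \<in> X \<longleftrightarrow> y \<in> X" for y
    using perm other.perm by (simp_all add: permutes_in_image)
  have \<tau>: "\<tau> x \<in> ?A S \<longleftrightarrow> x \<notin> ?A S" if "x \<in> X" for x S
  proof -
    have "rep (\<tau> x) = rep x"
      using self_in_orbit by (intro rep_cong) (auto simp: block_def)
    then show ?thesis
      using that rep_orbit_cases[OF that] X by auto
  qed
  have \<sigma>: "\<sigma> x \<in> ?A S \<longleftrightarrow> x \<notin> ?A S" if "x \<in> X" for x S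
  proof -
    \<comment> \<open>The rotation sends \<open>\<sigma> x\<close> to \<open>\<tau> x\<close>, so
      both lie in the same half and the claim reduces to the one for \<open>\<tau>\<close>.\<close>
    have *: "\<tau> x \<in> orbit rotation (\<sigma> x)"
      using orbit.base[of rotation "\<sigma> x"] by (simp add: rotation_def other.invol)
    then have "rep (\<tau> x) = rep (\<sigma> x)"
      by (intro rep_cong) (auto simp: block_def)
    moreover have "\<tau> x \<in> orbit rotation z \<longleftrightarrow> \<sigma> x \<in> orbit rotation z" for z
      using * orbit_sym orbit_trans by metis
    ultimately show ?thesis
      using \<tau>[OF that] that X by auto
  qed
  have "card (Pow (rep ` X)) \<le> card (transversals X \<tau> \<inter> transversals X \<sigma>)"
  proof (rule card_inj_on_le)
    show "inj_on ?A (Pow (rep ` X))"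
    proof (rule inj_onI)
      fix S S' assume S: "S \<in> Pow (rep ` X)" "S' \<in> Pow (rep ` X)" "?A S = ?A S'"
      have "r \<in> S \<longleftrightarrow> r \<in> S'" if "r \<in> rep ` X" for r
      proof -
        have "r \<in> X" "rep r = r"
          using that rep_in rep_in_block rep_cong by auto
        moreover have "r \<in> orbit rotation r"
          by (rule self_in_orbit)
        moreover have "r \<in> ?A S \<longleftrightarrow> r \<in> ?A S'"
          by (simp only: S(3))
        ultimately show ?thesis
          by simp
      qed
      then show "S = S'"
        using S(1,2) by blast
    qed
    show "?A ` Pow (rep ` X) \<subseteq> transversals X \<tau> \<inter> transversals X \<sigma>"
      using \<tau> \<sigma> unfolding transversals_def by blast
  qed (simp add: fin finite_transversals)
  then show ?thesis
    by (simp add: card_Pow fin)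
qed

text \<open>A permutation commuting with both involutions is determined by the images of one point
  in each block.\<close>

lemma card_common_centralizer_le:
  "card {h. h permutes X \<and> h \<circ> \<tau> = \<tau> \<circ> h \<and> h \<circ> \<sigma> = \<sigma> \<circ> h} \<le> card X ^ card (rep ` X)"
proof -
  let ?H = "{h. h permutes X \<and> h \<circ> \<tau> = \<tau> \<circ> h \<and> h \<circ> \<sigma> = \<sigma> \<circ> h}"
  have "card ?H \<le> card (rep ` X \<rightarrow>\<^sub>E X)"
  proof (rule card_inj_on_le)
    show "inj_on (\<lambda>h. restrict h (rep ` X)) ?H"
    proof (rule inj_onI, rule ext)
      fix h k x
      assume h: "h \<in> ?H" and k: "k \<in> ?H"
        and eq: "restrict h (rep ` X) = restrict k (rep ` X)"
      \<comment> \<open>Commuting with the rotation spreads agreement at \<open>rep x\<close> over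
        its half of the block; commuting with \<open>\<tau>\<close> then carries it to the other
        half.\<close>
      have pow: "f ((rotation ^^ n) z) = (rotation ^^ n) (f z)" if "f \<in> ?H" for f n z
        using that by (induction n) (auto simp: rotation_def fun_eq_iff)
      show "h x = k x"
      proof (cases "x \<in> X")
        case True
        then have r: "h (rep x) = k (rep x)"
          using eq by (metis imageI restrict_apply')
        have orb: "h z = k z" if "z \<in> orbit rotation (rep x)" for z
          using that r pow[OF h] pow[OF k] by (auto simp: orbit_rotation_iff)
        have "h (\<tau> x) = \<tau> (h x)" "k (\<tau> x) = \<tau> (k x)"
          using h k by (auto simp: fun_eq_iff)
        then show ?thesis
          using orb rep_orbit_cases[OF True] invol by metis
      next
        case False
        then show ?thesis
          using h k by (metis (mono_tags, lifting) mem_Collect_eq permutes_not_in)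
      qed
    qed
    show "(\<lambda>h. restrict h (rep ` X)) ` ?H \<subseteq> rep ` X \<rightarrow>\<^sub>E X"
      using rep_in by (auto simp: permutes_in_image)
    show "finite (rep ` X \<rightarrow>\<^sub>E X)"
      using fin by (intro finite_PiE) auto
  qed
  also have "\<dots> = card X ^ card (rep ` X)"
    using fin by (simp add: card_funcsetE)
  finally show ?thesis .
qed

end

section \<open>The pairing and the intersection of conjugate centralizers\<close>

lemma pairing_eq:
  "pairing m x = (if x \<in> {1..2 * m} then if even x then x - 1 else x + 1 else x)"
proof (induction m arbitrary: x)
  case (Suc m)
  show ?case
    unfolding pairing.simps comp_apply Suc
    by (cases "x = 2 * m + 1"; cases "x = 2 * m + 2") (auto elim!: evenE oddE)
qed simp

interpretation pairing: fpf_involution "{1..2 * m}" "pairing m" for m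
proof
  show "pairing m permutes {1..2 * m}"
    by (rule pairing_permutes)
  show "pairing m (pairing m x) = x" for x
    unfolding pairing_eq by simp presburger
qed (auto simp: pairing_eq)

lemma pairing_centralizer_meet_subset:
  assumes "g permutes {1..2 * m}"
  shows "pairing_centralizer_meet m g \<subseteq> {h. h permutes {1..2 * m} \<and> h \<circ> pairing m = pairing m \<circ> h
    \<and> h \<circ> (g \<circ> pairing m \<circ> inv' g) = (g \<circ> pairing m \<circ> inv' g) \<circ> h}"
proof
  fix h assume h: "h \<in> pairing_centralizer_meet m g"
  have "inv\<^bsub>sym_group (2 * m)\<^esub> g = inv' g"
    using assms by (simp add: sym_group_inv_equality sym_group_carrier)
  then obtain k where k: "h = g \<circ> k \<circ> inv' g" "k \<circ> pairing m = pairing m \<circ> k"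
    using h by (auto simp: pairing_centralizer_meet_def conj_subgroup_def pairing_centralizer_def
        centralizer_def l_coset_def r_coset_def sym_group_mult)
  have "h \<circ> (g \<circ> pairing m \<circ> inv' g) = (g \<circ> pairing m \<circ> inv' g) \<circ> h"
    using k(2) assms unfolding k(1) by (simp add: fun_eq_iff permutes_inverses)
  then show "h \<in> {h. h permutes {1..2 * m} \<and> h \<circ> pairing m = pairing m \<circ> h
    \<and> h \<circ> (g \<circ> pairing m \<circ> inv' g) = (g \<circ> pairing m \<circ> inv' g) \<circ> h}"
    using h by (simp add: pairing_centralizer_meet_def pairing_centralizer_def centralizer_def
        sym_group_mult sym_group_carrier)
qed

text \<open>Here \<open>K\<close> is the number of blocks; obtaining it as a bare number keeps the
  representatives out of the counting that follows.\<close>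

lemma pairing_centralizer_meet_bound:
  assumes "g permutes {1..2 * m}"
  obtains K where "card (pairing_centralizer_meet m g) \<le> (2 * m) ^ K"
    "2 ^ K \<le> card (transversals {1..2 * m} (pairing m)
      \<inter> transversals {1..2 * m} (g \<circ> pairing m \<circ> inv' g))"
proof -
  let ?\<sigma> = "g \<circ> pairing m \<circ> inv' g"
  interpret other: fpf_involution "{1..2 * m}" ?\<sigma>
    by (rule pairing.conjugate[OF assms])
  interpret fpf_involution_pair "{1..2 * m}" "pairing m" ?\<sigma> ..
  have "card (pairing_centralizer_meet m g) \<le> card {h. h permutes {1..2 * m}
      \<and> h \<circ> pairing m = pairing m \<circ> h \<and> h \<circ> ?\<sigma> = ?\<sigma> \<circ> h}"
    by (intro card_mono pairing_centralizer_meet_subset assms)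
      (simp add: finite_subset[OF _ finite_permutations[of "{1..2 * m}"]] subset_iff)
  also have "\<dots> \<le> (2 * m) ^ card (rep ` {1..2 * m})"
    using card_common_centralizer_le by simp
  finally show thesis
    using two_power_blocks_le that by blast
qed

section \<open>Asymptotic estimates\<close>

text \<open>This is the lower bound 4^m / (2 \<open>sqrt m\<close>) for the central binomial
  coefficient.\<close>

lemma four_power_fact_le:
  assumes "m \<ge> 1"
  shows "(2 ^ m * fact m)\<^sup>2 \<le> 2 * sqrt m * (fact (2 * m) :: real)"
  using assms
proof (induction m rule: dec_induct)
  case base
  then show ?case by (simp add: numeral_2_eq_2)
next
  case (step m)
  have "sqrt (4 * m * t) * sqrt t = 2 * sqrt m * t" if "t \<ge> 0" for t
    using that by (simp add: real_sqrt_mult)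
  from this[of "m + 1"] have "2 * sqrt m * (m + 1) = sqrt (4 * m * (m + 1)) * sqrt (m + 1)"
    by simp
  \<comment> \<open>The inductive step comes down to 4m(m+1) \<le> (2m+1)^2.\<close>
  also have "\<dots> \<le> sqrt ((2 * m + 1)\<^sup>2) * sqrt (m + 1)"
    by (intro mult_right_mono) (auto simp: power2_eq_square algebra_simps)
  finally have "2 * sqrt m * (m + 1) \<le> (2 * m + 1) * sqrt (m + 1)"
    by simp
  then have ineq: "2 * (m + 1) * (2 * (m + 1) * sqrt m) \<le> 2 * (m + 1) * ((2 * m + 1) * sqrt (m + 1))"
    by (intro mult_left_mono) (auto simp: algebra_simps)
  have "(2 ^ Suc m * fact (Suc m))\<^sup>2 = 4 * (real m + 1)\<^sup>2 * (2 ^ m * fact m :: real)\<^sup>2"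
  proof -
    have "2 ^ Suc m * fact (Suc m) = 2 * (real m + 1) * (2 ^ m * fact m)"
      by (simp add: algebra_simps)
    then show ?thesis
      by (simp add: power_mult_distrib)
  qed
  also have "\<dots> \<le> 4 * (real m + 1)\<^sup>2 * (2 * sqrt m * fact (2 * m))"
    by (intro mult_left_mono step.IH) auto
  also have "\<dots> = 2 * (2 * (m + 1) * (2 * (m + 1) * sqrt m)) * fact (2 * m)"
    by (simp add: power2_eq_square algebra_simps)
  also have "\<dots> \<le> 2 * (2 * (m + 1) * ((2 * m + 1) * sqrt (m + 1))) * fact (2 * m)"
    by (intro mult_right_mono mult_left_mono ineq) auto
  also have "\<dots> = 2 * sqrt (Suc m) * fact (2 * Suc m)"
    by (simp add: algebra_simps)
  finally show ?case .
qed

text \<open>With L = \<open>ln m\<close>, taking logarithms gives K \<ge> (L^2 +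
  \<open>ln c\<close>) / (L + \<open>ln 2\<close>), which is eventually at least L - 2; any constant
  above \<open>ln 2\<close> could replace 2. The factor 1/4 is 2^(-2). The threshold for
  \<open>m\<close> is uniform in \<open>K\<close>, as \<open>K\<close> varies with
  \<open>g\<close>.\<close>

lemma eventually_power_exponent_ge:
  fixes c :: real
  assumes "c > 0"
  shows "\<forall>\<^sub>F m::nat in sequentially. \<forall>K::nat.
    c * real m powr ln (real m) \<le> (2 * real m) ^ K \<longrightarrow> real m powr ln 2 / 4 \<le> 2 ^ K"
proof -
  have "\<forall>\<^sub>F m::nat in sequentially. ((ln (real m) - 2) * (ln 2 + ln (real m)) \<le> ln c + ln (real m) * ln (real m))"
    by real_asymp
  then show ?thesis
    using eventually_ge_at_top[of 1]
  proof eventually_elim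
    case (elim m)
    show ?case
    proof (intro allI impI)
      fix K assume "c * real m powr ln (real m) \<le> (2 * real m) ^ K"
      then have "ln (c * real m powr ln (real m)) \<le> ln ((2 * real m) ^ K)"
        using assms elim by (intro ln_mono) auto
      then have "ln c + ln (real m) * ln (real m) \<le> real K * (ln 2 + ln (real m))"
        using assms elim by (simp add: ln_mult ln_realpow distrib_left)
      then have "(ln (real m) - 2) * (ln 2 + ln (real m)) \<le> real K * (ln 2 + ln (real m))"
        using elim(1) by linarith
      moreover have "ln 2 + ln (real m) > 0"
        using elim by (simp add: add_pos_nonneg)
      ultimately have "ln (real m) - 2 \<le> real K"
        using mult_le_cancel_right_pos by blast
      then have "2 powr (ln (real m) - 2) \<le> (2::real) powr real K"
        by simp
      moreover have "(2::real) powr (ln (real m) - 2) = real m powr ln 2 / 4"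
      proof -
        have "(2::real) powr ln (real m) = real m powr ln 2"
          using elim by (simp add: powr_def mult.commute)
        then show ?thesis
          by (simp add: powr_diff)
      qed
      ultimately show "real m powr ln 2 / 4 \<le> 2 ^ K"
        by (simp add: powr_realpow)
    qed
  qed
qed

section \<open>Markov's inequality and the density statement\<close>

lemma large_meet_density_tendsto:
  fixes c :: real
  assumes "c > 0"
  shows "(\<lambda>m::nat. real (card {g \<in> carrier (sym_group (2 * m)).
      real (card (pairing_centralizer_meet m g)) \<ge> c * real m powr ln (real m)}) / fact (2 * m))
    \<longlonglongrightarrow> 0" (is "(\<lambda>m. real (card (?bad m)) / fact (2 * m)) \<longlonglongrightarrow> 0")
proof (rule tendsto_sandwich[of "\<lambda>_. 0"])
  \<comment> \<open>The exponent 1/2 comes from the central binomial bound and \<open>ln 2\<close>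
    from the threshold on 2^K, so this makes the upper bound tend to 0.\<close>
  have "ln 2 > (1/2 :: real)"
    using ln2_ge_two_thirds by linarith
  then show "(\<lambda>m::nat. 8 * real m powr (1/2 - ln 2)) \<longlonglongrightarrow> 0"
    by real_asymp
  show "\<forall>\<^sub>F m in sequentially. real (card (?bad m)) / fact (2 * m) \<le> 8 * real m powr (1/2 - ln 2)"
    using eventually_power_exponent_ge[OF assms] eventually_ge_at_top[of 1]
  proof eventually_elim
    case (elim m)
    let ?N = "\<lambda>g. card (transversals {1..2 * m} (pairing m)
      \<inter> transversals {1..2 * m} (g \<circ> pairing m \<circ> inv' g))"
    have N: "real m powr ln 2 / 4 \<le> real (?N g)" if "g \<in> ?bad m" for g
    proof -
      have "g permutes {1..2 * m}"
        using that by (simp add: sym_group_carrier)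
      then obtain K where K: "card (pairing_centralizer_meet m g) \<le> (2 * m) ^ K" "2 ^ K \<le> ?N g"
        by (rule pairing_centralizer_meet_bound)
      have "real (card (pairing_centralizer_meet m g)) \<le> (2 * real m) ^ K"
        using of_nat_mono[OF K(1), where 'a = real] by simp
      then have "real m powr ln 2 / 4 \<le> 2 ^ K"
        using that elim(1) by (metis (mono_tags, lifting) mem_Collect_eq order_trans)
      also have "\<dots> \<le> real (?N g)"
        using of_nat_mono[OF K(2), where 'a = real] by simp
      finally show ?thesis .
    qed
    have "real (card (?bad m)) * (real m powr ln 2 / 4) \<le> (\<Sum>g\<in>?bad m. real (?N g))"
      using sum_bounded_below[of "?bad m" "real m powr ln 2 / 4" "\<lambda>g. real (?N g)"] N by simp
    also have "\<dots> \<le> (\<Sum>g | g permutes {1..2 * m}. real (?N g))"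
      by (intro sum_mono2 finite_permutations) (auto simp: sym_group_carrier)
    also have "\<dots> \<le> (2 ^ m * fact m)\<^sup>2"
      using of_nat_mono[OF pairing.sum_card_common_transversals_le[of m], where 'a = real] by simp
    also have "\<dots> \<le> 2 * sqrt m * fact (2 * m)"
      by (rule four_power_fact_le[OF elim(2)])
    finally have "real (card (?bad m)) / fact (2 * m) \<le> 8 * (sqrt m / real m powr ln 2)"
      using elim(2) by (simp add: field_simps)
    then show ?case
      using elim(2) by (simp add: powr_diff powr_half_sqrt)
  qed
qed auto

theorem theorem0p3:
  shows "(\<exists>C>0::real.
            (\<lambda>m::nat. real (card {g \<in> carrier (sym_group (2 * m)).
                 real (card (pairing_centralizer_meet m g)) > C * real m powr ln (real m)})
               / fact (2 * m)) \<longlonglongrightarrow> 0)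
       \<and> (\<forall>c>0::real.
            (\<lambda>m::nat. real (card {g \<in> carrier (sym_group (2 * m)).
                 real (card (pairing_centralizer_meet m g)) \<ge> c * real m powr ln (real m)})
               / fact (2 * m)) \<longlonglongrightarrow> 0)"
\<comment> \<open>Any positive constant can serve as \<open>C\<close>; with 1, the first claim
  follows from the second at \<open>c = 1\<close>, since the strict inequality defines a smaller
  set.\<close>
proof (intro conjI allI impI exI[of _ 1])
  have fin: "finite (carrier (sym_group n))" for n
    by (simp add: sym_group_def finite_permutations)
  show "(\<lambda>m::nat. real (card {g \<in> carrier (sym_group (2 * m)).
      real (card (pairing_centralizer_meet m g)) > 1 * real m powr ln (real m)}) / fact (2 * m)) \<longlonglongrightarrow> 0"
  proof (rule tendsto_sandwich[OF _ _ tendsto_const large_meet_density_tendsto[of 1]])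
    show "\<forall>\<^sub>F m::nat in sequentially. real (card {g \<in> carrier (sym_group (2 * m)).
        real (card (pairing_centralizer_meet m g)) > 1 * real m powr ln (real m)}) / fact (2 * m)
      \<le> real (card {g \<in> carrier (sym_group (2 * m)).
        real (card (pairing_centralizer_meet m g)) \<ge> 1 * real m powr ln (real m)}) / fact (2 * m)"
      using fin by (intro always_eventually allI divide_right_mono of_nat_mono card_mono) auto
  qed auto
qed (auto intro: large_meet_density_tendsto)

end
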